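(* Let $g>0$, $H>0$, $U\in\mathbb R$, $P\ge1$, $\Delta x>0$, and let $\alpha_h\ge0$, $\alpha_u\ge0$ be real. Let $\mathbf h(t),\mathbf u(t)\in\mathbb R^{2P+2}$, $t\ge0$, be continuously differentiable solutions of the semi-discrete two-element scheme $$\frac{d\mathbf h}{dt}+\mathbf D(H\mathbf u+U\mathbf h)=\tau_{11}H\mathbf K\mathbf u+\tau_{12}U\mathbf K\mathbf h-\alpha_h\mathbf M^{-1}\widetilde{\mathbf B}^\top\widetilde{\mathbf B}\mathbf h,$$ $$\begin{aligned}\frac{d\mathbf u}{dt}&+\mathbf D\left(g\mathbf h+U\mathbf u-\frac{H^2U}{3}\mathbf D^2\mathbf u-\frac{H^2}{3}\mathbf D\frac{d\mathbf u}{dt}\right)=\tau_{21}g\mathbf K\mathbf h+\tau_{22}U\mathbf K\mathbf u\\&+H^2\left(\gamma_{21}\mathbf D\mathbf K+\gamma_{22}\mathbf K\mathbf D+\gamma_{23}\mathbf K^2\right)\frac{d\mathbf u}{dt}\\&+H^2U\left(\sigma_{21}\mathbf D^2\mathbf K+\sigma_{22}\mathbf D\mathbf K\mathbf D+\sigma_{23}\mathbf D\mathbf K^2+\sigma_{24}\mathbf K\mathbf D^2+\sigma_{25}\mathbf K\mathbf D\mathbf K+\sigma_{26}\mathbf K^2\mathbf D+\sigma_{27}\mathbf K^3\right)\mathbf u-\alpha_u\mathbf M^{-1}\widetilde{\mathbf B}^\top\widetilde{\mathbf B}\mathbf u,\end{aligned}$$ where $\mathbf K=\mathbf M^{-1}\widetilde{\mathbf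 B}$ and $\tau_{11}=\tau_{12}=\tau_{21}=\tau_{22}=\frac12$, $\gamma_{21}=\gamma_{22}=\sigma_{21}=\sigma_{22}=\sigma_{24}=-\frac16$, $\gamma_{23}=\sigma_{23}=\sigma_{25}=\sigma_{26}=\frac1{12}$, $\sigma_{27}=-\frac1{24}$. Define the discrete energy $$E_{\mathbf M}(t)=\frac g2\|\mathbf h\|^2_{\mathbf M}+\frac H2\|\mathbf u\|^2_{\mathbf M}+\frac{H^3}{6}\|\widetilde{\mathbf D}\mathbf u\|^2_{\mathbf M}.$$ Considering only boundary contributions from the interface (see context), $E_{\mathbf M}(t)\le E_{\mathbf M}(0)$ for all $t\ge0$.
   Context: Operators: let $-1=\xi_1<\dots<\xi_{P+1}=1$ be the Gauss–Lobatto quadrature nodes on $[-1,1]$ with weights $\omega_i>0$ (exact for polynomials of degree $\le2P-1$), $\ell_j$ the Lagrange polynomials at these nodes, $M=\operatorname{diag}(\omega_1,\dots,\omega_{P+1})$, $Q_{ij}=\int_{-1}^1\ell_i\ell_j'\,d\xi=\sum_k\omega_k\ell_i(\xi_k)\ell_j'(\xi_k)$, $D=M^{-1}Q$, $D_x=\frac2{\Delta x}D$, $M_x=\frac{\Delta x}2M$. Then $M_xD_x+D_x^\top M_x=\operatorname{diag}(-1,0,\dots,0,1)$. Two-element model: the elements $\Omega^-$ (left) and $\Omega^+$ (right) share an interface, each of length $\Delta x$; grid vectors in $\mathbb R^{2P+2}$ are stacked as $\mathbf v=[\mathbf v^-;\mathbf v^+]$ with $\mathbf v^\pm\in\mathbb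 R^{P+1}$. Let $\mathbf D=\operatorname{diag}(D_x,D_x)$, $\mathbf M=\operatorname{diag}(M_x,M_x)$ (block diagonal), $\mathbf e_L=(1,0,\dots,0)^\top$, $\mathbf e_R=(0,\dots,0,1)^\top\in\mathbb R^{P+1}$, $$\widetilde{\mathbf B}=\begin{bmatrix}\mathbf e_R\mathbf e_R^\top&-\mathbf e_R\mathbf e_L^\top\\\mathbf e_L\mathbf e_R^\top&-\mathbf e_L\mathbf e_L^\top\end{bmatrix},\qquad\widetilde{\mathbf D}=\mathbf D-\frac12\mathbf M^{-1}\widetilde{\mathbf B},\qquad\|\mathbf u\|^2_{\mathbf M}=\mathbf u^\top\mathbf M\mathbf u.$$ "Considering only boundary contributions from the interface" means that the contributions of the outer end nodes (first node of $\Omega^-$, last node of $\Omega^+$) produced by summation by parts with $\widetilde{\mathbf D}$ are absent: writing, entrywise for grid vectors, $$b=-gHhu-\frac{gU}{2}h^2-\frac{HU}{2}u^2+\frac{H^3U}{3}\left(u\,(\widetilde{\mathbf D}^2\mathbf u)-\frac12(\widetilde{\mathbf D}\mathbf u)^2\right)+\frac{H^3}{3}u\left(\widetilde{\mathbf D}\frac{d\mathbf u}{dt}\right),$$ it is assumed that $b^+_{P+1}-b^-_1=0$ for all $t\ge0$. *)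

theory Defs
  imports "HOL-Analysis.Analysis" "Jordan_Normal_Form.Gauss_Jordan_Elimination"
begin

unbundle no vec_syntax

text \<open>
  Vectors and matrices are those of \<^theory>\<open>Jordan_Normal_Form.Matrix\<close>, indexed from 0:
  node \<open>\<xi>\<^sub>k\<^sub>+\<^sub>1\<close> of the literature is \<open>\<xi> k\<close> for \<open>k = 0, \<dots>, P\<close>.  A two-element grid
  vector has length \<open>2 * (P + 1)\<close>; its entries \<open>0, \<dots>, P\<close> belong to the left element and
  \<open>P + 1, \<dots>, 2 * P + 1\<close> to the right one.
\<close>

text \<open>
  The Gauss--Lobatto rule with \<open>P + 1\<close> nodes is the quadrature rule containing both end points
  that has the maximal degree of exactness \<open>2 * P - 1\<close>; these conditions determine it.
\<close>

definition gauss_lobatto :: "nat \<Rightarrow> (nat \<Rightarrow> real) \<Rightarrow> (nat \<Rightarrow> real) \<Rightarrow> bool" where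
  "gauss_lobatto P \<xi> \<omega> \<longleftrightarrow>
     strict_mono_on {..P} \<xi> \<and> \<xi> 0 = -1 \<and> \<xi> P = 1 \<and> (\<forall>k\<le>P. 0 < \<omega> k) \<and>
     (\<forall>p :: real poly. degree p \<le> 2 * P - 1 \<longrightarrow>
        (\<Sum>k\<le>P. \<omega> k * poly p (\<xi> k)) = integral {-1..1} (poly p))"

definition lagrange_basis :: "nat \<Rightarrow> (nat \<Rightarrow> real) \<Rightarrow> nat \<Rightarrow> real poly" where
  "lagrange_basis P \<xi> j =
     (\<Prod>k\<in>{..P} - {j}. Polynomial.smult (1 / (\<xi> j - \<xi> k)) [:- \<xi> k, 1:])"

text \<open>Meaningful for invertible matrices only.\<close>

definition minv :: "real mat \<Rightarrow> real mat" where
  "minv A = the (mat_inverse A)"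

definition outer_prod :: "real Matrix.vec \<Rightarrow> real Matrix.vec \<Rightarrow> real mat" where
  "outer_prod v w = Matrix.mat (dim_vec v) (dim_vec w) (\<lambda>(i, j). v $ i * w $ j)"

definition ref_mass :: "nat \<Rightarrow> (nat \<Rightarrow> real) \<Rightarrow> real mat" where
  "ref_mass P \<omega> = mat_diag (P + 1) \<omega>"

definition ref_stiff :: "nat \<Rightarrow> (nat \<Rightarrow> real) \<Rightarrow> real mat" where
  "ref_stiff P \<xi> = Matrix.mat (P + 1) (P + 1) (\<lambda>(i, j).
     integral {-1..1} (\<lambda>x. poly (lagrange_basis P \<xi> i) x * poly (pderiv (lagrange_basis P \<xi> j)) x))"

definition ref_deriv :: "nat \<Rightarrow> (nat \<Rightarrow> real) \<Rightarrow> (nat \<Rightarrow> real) \<Rightarrow> real mat" where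
  "ref_deriv P \<xi> \<omega> = minv (ref_mass P \<omega>) * ref_stiff P \<xi>"

definition elem_mass :: "nat \<Rightarrow> (nat \<Rightarrow> real) \<Rightarrow> real \<Rightarrow> real mat" where
  "elem_mass P \<omega> \<Delta>x = (\<Delta>x / 2) \<cdot>\<^sub>m ref_mass P \<omega>"

definition elem_deriv :: "nat \<Rightarrow> (nat \<Rightarrow> real) \<Rightarrow> (nat \<Rightarrow> real) \<Rightarrow> real \<Rightarrow> real mat" where
  "elem_deriv P \<xi> \<omega> \<Delta>x = (2 / \<Delta>x) \<cdot>\<^sub>m ref_deriv P \<xi> \<omega>"

definition global_mass :: "nat \<Rightarrow> (nat \<Rightarrow> real) \<Rightarrow> real \<Rightarrow> real mat" where
  "global_mass P \<omega> \<Delta>x =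
     four_block_mat (elem_mass P \<omega> \<Delta>x) (0\<^sub>m (P + 1) (P + 1))
                    (0\<^sub>m (P + 1) (P + 1)) (elem_mass P \<omega> \<Delta>x)"

definition global_deriv :: "nat \<Rightarrow> (nat \<Rightarrow> real) \<Rightarrow> (nat \<Rightarrow> real) \<Rightarrow> real \<Rightarrow> real mat" where
  "global_deriv P \<xi> \<omega> \<Delta>x =
     four_block_mat (elem_deriv P \<xi> \<omega> \<Delta>x) (0\<^sub>m (P + 1) (P + 1))
                    (0\<^sub>m (P + 1) (P + 1)) (elem_deriv P \<xi> \<omega> \<Delta>x)"

definition interface_mat :: "nat \<Rightarrow> real mat" where
  "interface_mat P =
     (let eL = unit_vec (P + 1) 0; eR = unit_vec (P + 1) P
      in four_block_mat (outer_prod eR eR) (- outer_prod eR eL)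
                        (outer_prod eL eR) (- outer_prod eL eL))"

definition sq_norm_wrt :: "real mat \<Rightarrow> real Matrix.vec \<Rightarrow> real" where
  "sq_norm_wrt M v = scalar_prod v (M *\<^sub>v v)"

definition energy ::
  "real \<Rightarrow> real \<Rightarrow> real mat \<Rightarrow> real mat \<Rightarrow> real Matrix.vec \<Rightarrow> real Matrix.vec \<Rightarrow> real" where
  "energy g H M Dt h u =
     g / 2 * sq_norm_wrt M h + H / 2 * sq_norm_wrt M u + H ^ 3 / 6 * sq_norm_wrt M (Dt *\<^sub>v u)"

text \<open>
  The entrywise flux left over by summation by parts with \<open>Dt\<close> in the energy rate; \<open>u'\<close> stands
  for the time derivative of \<open>u\<close>.
\<close>

definition boundary_flux ::
  "real \<Rightarrow> real \<Rightarrow> real \<Rightarrow> real mat \<Rightarrow> real Matrix.vec \<Rightarrow> real Matrix.vec \<Rightarrow> real Matrix.vec \<Rightarrow> real Matrix.vec"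
where
  "boundary_flux g H U Dt h u u' = Matrix.vec (dim_vec u) (\<lambda>i.
     - (g * H * h $ i * u $ i) - g * U / 2 * (h $ i)\<^sup>2 - H * U / 2 * (u $ i)\<^sup>2
     + H ^ 3 * U / 3 * (u $ i * ((Dt * Dt) *\<^sub>v u) $ i - 1 / 2 * ((Dt *\<^sub>v u) $ i)\<^sup>2)
     + H ^ 3 / 3 * (u $ i * (Dt *\<^sub>v u') $ i))"

text \<open>
  \<open>v\<close> is continuously differentiable on \<open>[0, \<infinity>)\<close> (one-sided at 0) with derivative \<open>v'\<close>.  The type
  of vectors of arbitrary length carries no topology, hence the formulation by components.
\<close>

definition C1_with_deriv ::
  "nat \<Rightarrow> (real \<Rightarrow> real Matrix.vec) \<Rightarrow> (real \<Rightarrow> real Matrix.vec) \<Rightarrow> bool" where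
  "C1_with_deriv n v v' \<longleftrightarrow>
     (\<forall>t\<ge>0. v t \<in> carrier_vec n \<and> v' t \<in> carrier_vec n) \<and>
     (\<forall>i<n. (\<forall>t\<ge>0. ((\<lambda>s. v s $ i) has_real_derivative v' t $ i) (at t within {0..})) \<and>
            continuous_on {0..} (\<lambda>t. v' t $ i))"

end

theory Submission
  imports Defs
begin

text \<open>
  Since \<open>Dt = D - K / 2\<close>, the penalty coefficients are exactly those for which the scheme becomes the
  original system with \<open>D\<close> replaced by \<open>Dt\<close>, up to the dissipative jump terms.  The operator \<open>Dt\<close>
  satisfies summation by parts across the interface, \<open>M Dt + Dt\<^sup>T M = diag(-1, 0, \<dots>, 0, 1)\<close>, because the
  symmetric part of \<open>B\<close> removes the two interface boundary terms.  In the energy rate the terms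
  containing \<open>Dt\<^sup>2 u'\<close> cancel and \<open>u\<^sup>T M Dt\<^sup>3 u\<close> reduces to boundary terms, so only the outer flux and
  \<open>- g \<alpha>h |B h|\<^sup>2 - H \<alpha>u |B u|\<^sup>2\<close> remain.
\<close>

unbundle no inner_syntax

section \<open>Inverses of diagonal matrices\<close>

text \<open>\<open>mat_inverse\<close> is specified through the units of the matrix ring, so the
  exhibited inverse \<open>C\<close> first excludes the value \<open>None\<close>. The matrix
  returned is then \<open>C\<close> by uniqueness of inverses,
  \<open>A' = A' (A C) = (A' A) C\<close>.\<close>

lemma minv_inverse:
  assumes "A \<in> carrier_mat n n" "C \<in> carrier_mat n n" "A * C = 1\<^sub>m n" "C * A = 1\<^sub>m n"
  shows "minv A = C"
proof -
  have "A \<in> Units (ring_mat TYPE(real) n ())"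
    using assms unfolding Units_def ring_mat_def by auto
  then obtain A' where A': "mat_inverse A = Some A'"
    using mat_inverse(1)[OF assms(1), where b = "()"] by (cases "mat_inverse A") simp_all
  note inv = mat_inverse(2)[OF assms(1) A']
  have "A' = A' * (A * C)" using inv assms(3) by (simp add: right_mult_one_mat[of _ n n])
  also have "\<dots> = (A' * A) * C"
    using inv assms by (intro assoc_mult_mat[symmetric]) auto
  also have "\<dots> = C" using inv assms by simp
  finally show ?thesis by (simp add: minv_def A')
qed

lemma minv_mat_diag:
  assumes "\<And>i. i < n \<Longrightarrow> f i \<noteq> (0::real)"
  shows "minv (mat_diag n f) = mat_diag n (\<lambda>i. 1 / f i)"
    and "mat_diag n f * minv (mat_diag n f) = 1\<^sub>m n"
proof -
  have eq: "mat_diag n (\<lambda>i. f i * (1 / f i)) = 1\<^sub>m n" "mat_diag n (\<lambda>i. 1 / f i * f i) = 1\<^sub>m n"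
    unfolding mat_diag_def by (rule eq_matI; use assms in force)+
  then show *: "minv (mat_diag n f) = mat_diag n (\<lambda>i. 1 / f i)"
    by (intro minv_inverse[of _ n]) (simp_all only: mat_diag_diag mat_diag_dim)
  show "mat_diag n f * minv (mat_diag n f) = 1\<^sub>m n"
    unfolding * using eq by (simp only: mat_diag_diag)
qed

section \<open>Lagrange polynomials and summation by parts on the reference element\<close>

lemma poly_lagrange_basis:
  assumes "inj_on \<xi> {..P}" "i \<le> P" "j \<le> P"
  shows "poly (lagrange_basis P \<xi> j) (\<xi> i) = (if i = j then 1 else 0)"
proof (cases "i = j")
  case True
  then show ?thesis
    using assms inj_on_eq_iff[OF assms(1)]
    by (auto simp: lagrange_basis_def poly_prod simp flip: diff_divide_distrib intro!: prod.neutral)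
next
  case False
  then show ?thesis
    using assms by (auto simp: lagrange_basis_def poly_prod intro!: prod_zero bexI[of _ i])
qed

text \<open>Integration by parts: the two integrands add up to the derivative of the product of the
  two Lagrange polynomials. The end points are the first and last node, where these polynomials take
  Kronecker delta values.\<close>

lemma ref_stiff_sbp:
  assumes "inj_on \<xi> {..P}" "\<xi> 0 = -1" "\<xi> P = 1" "i \<le> P" "j \<le> P"
  shows "ref_stiff P \<xi> $$ (i, j) + ref_stiff P \<xi> $$ (j, i)
           = of_bool (i = P \<and> j = P) - of_bool (i = 0 \<and> j = 0)"
proof -
  let ?l = "lagrange_basis P \<xi>"
  have int: "(\<lambda>x. poly (?l i) x * poly (pderiv (?l j)) x) integrable_on {-1..1}" for i j
    by (intro integrable_continuous_interval continuous_intros)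
  have "((\<lambda>x. poly (pderiv (?l i * ?l j)) x) has_integral
          poly (?l i * ?l j) 1 - poly (?l i * ?l j) (-1)) {-1..1}"
    by (intro fundamental_theorem_of_calculus)
       (auto simp flip: has_real_derivative_iff_has_vector_derivative
             simp del: poly_mult intro: poly_DERIV has_field_derivative_at_within)
  then have "integral {-1..1} (\<lambda>x. poly (pderiv (?l i * ?l j)) x)
      = poly (?l i * ?l j) (\<xi> P) - poly (?l i * ?l j) (\<xi> 0)"
    using assms by (simp add: integral_unique)
  also have "\<dots> = of_bool (i = P \<and> j = P) - of_bool (i = 0 \<and> j = 0)"
    unfolding poly_mult using assms(1,4,5) by (subst (1 2 3 4) poly_lagrange_basis) auto
  also have "integral {-1..1} (\<lambda>x. poly (pderiv (?l i * ?l j)) x)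
      = ref_stiff P \<xi> $$ (i, j) + ref_stiff P \<xi> $$ (j, i)"
    using assms by (simp add: ref_stiff_def pderiv_mult flip: integral_add[OF int int])
  finally show ?thesis .
qed

section \<open>Two-element operators and summation by parts across the interface\<close>

text \<open>As a single diagonal matrix the block mass falls under \<open>minv_mat_diag\<close>.
  Indices beyond \<open>P\<close> are shifted back by \<open>P + 1\<close> to reach the weights of
  the right element.\<close>

lemma global_mass_eq:
  "global_mass P \<omega> \<Delta>x
     = mat_diag (2 * P + 2) (\<lambda>i. \<Delta>x / 2 * \<omega> (if i \<le> P then i else i - (P + 1)))"
  by (rule eq_matI) (auto simp: global_mass_def elem_mass_def ref_mass_def mat_diag_def)

lemma global_operators_carrier:
  assumes "\<And>k. k \<le> P \<Longrightarrow> 0 < \<omega> k" "0 < \<Delta>x"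
  defines "n \<equiv> 2 * P + 2" and "M \<equiv> global_mass P \<omega> \<Delta>x"
  shows "M \<in> carrier_mat n n" "minv M \<in> carrier_mat n n" "M * minv M = 1\<^sub>m n"
    "transpose_mat M = M" "global_deriv P \<xi> \<omega> \<Delta>x \<in> carrier_mat n n" "interface_mat P \<in> carrier_mat n n"
proof -
  let ?f = "\<lambda>i. \<Delta>x / 2 * \<omega> (if i \<le> P then i else i - (P + 1))"
  have nz: "?f i \<noteq> 0" if "i < n" for i
  proof -
    from that have "i - (P + 1) \<le> P" by (simp add: n_def)
    then show ?thesis using assms(1)[of i] assms(1)[of "i - (P + 1)"] assms(2) by auto
  qed
  have M: "M = mat_diag n ?f" unfolding M_def n_def by (rule global_mass_eq)
  show "M \<in> carrier_mat n n" unfolding M by simp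
  show "minv M \<in> carrier_mat n n" "M * minv M = 1\<^sub>m n"
    unfolding M using minv_mat_diag[of n ?f, OF nz] by (simp_all only: mat_diag_dim)
  show "transpose_mat M = M" unfolding M mat_diag_def by (rule eq_matI) auto
  have "minv (ref_mass P \<omega>) = mat_diag (P + 1) (\<lambda>i. 1 / \<omega> i)"
    unfolding ref_mass_def using assms(1) by (intro minv_mat_diag(1)) (metis Suc_eq_plus1 less_Suc_eq_le less_irrefl)
  then show "global_deriv P \<xi> \<omega> \<Delta>x \<in> carrier_mat n n"
    unfolding global_deriv_def elem_deriv_def ref_deriv_def ref_stiff_def n_def
    by (auto simp: mat_diag_def)
  show "interface_mat P \<in> carrier_mat n n"
    unfolding interface_mat_def outer_prod_def n_def Let_def by auto
qed

text \<open>In each block the mass cancels its inverse and the factors \<open>\<Delta>x / 2\<close>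
  and \<open>2 / \<Delta>x\<close> cancel each other, so that pure stiffness blocks remain, to which
  \<open>ref_stiff_sbp\<close> applies.\<close>

lemma mass_times_deriv:
  assumes "\<And>k. k \<le> P \<Longrightarrow> 0 < \<omega> k" "0 < \<Delta>x"
  shows "global_mass P \<omega> \<Delta>x * global_deriv P \<xi> \<omega> \<Delta>x
    = four_block_mat (ref_stiff P \<xi>) (0\<^sub>m (P + 1) (P + 1)) (0\<^sub>m (P + 1) (P + 1)) (ref_stiff P \<xi>)"
proof -
  have carr: "ref_mass P \<omega> \<in> carrier_mat (P+1) (P+1)"
      "minv (ref_mass P \<omega>) \<in> carrier_mat (P+1) (P+1)"
      "ref_stiff P \<xi> \<in> carrier_mat (P+1) (P+1)"
    using assms by (simp_all add: ref_mass_def ref_stiff_def minv_mat_diag(1) less_imp_neq[symmetric])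
  have "ref_mass P \<omega> * minv (ref_mass P \<omega>) = 1\<^sub>m (P+1)"
    unfolding ref_mass_def using assms(1)
    by (intro minv_mat_diag(2)) (metis Suc_eq_plus1 less_Suc_eq_le less_irrefl)
  then have "ref_mass P \<omega> * (minv (ref_mass P \<omega>) * ref_stiff P \<xi>) = ref_stiff P \<xi>"
    using carr by (simp flip: assoc_mult_mat[of _ "P+1" "P+1" _ "P+1" _ "P+1"])
  then have "elem_mass P \<omega> \<Delta>x * elem_deriv P \<xi> \<omega> \<Delta>x = (2 / \<Delta>x) \<cdot>\<^sub>m ((\<Delta>x / 2) \<cdot>\<^sub>m ref_stiff P \<xi>)"
    using carr unfolding elem_mass_def elem_deriv_def ref_deriv_def
    by (simp add: mult_smult_distrib[of _ "P+1" "P+1" _ "P+1"]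
         mult_smult_assoc_mat[of _ "P+1" "P+1" _ "P+1"])
  also have "\<dots> = ref_stiff P \<xi>"
    using \<open>0 < \<Delta>x\<close> by (intro eq_matI) auto
  finally have *: "elem_mass P \<omega> \<Delta>x * elem_deriv P \<xi> \<omega> \<Delta>x = ref_stiff P \<xi>" .
  have "elem_mass P \<omega> \<Delta>x \<in> carrier_mat (P+1) (P+1)" "elem_deriv P \<xi> \<omega> \<Delta>x \<in> carrier_mat (P+1) (P+1)"
    using carr by (auto simp: elem_mass_def elem_deriv_def ref_deriv_def)
  then show ?thesis using carr
    unfolding global_mass_def global_deriv_def
    by (subst mult_four_block_mat[where ?nr1.0="P+1" and ?n1.0="P+1" and ?n2.0="P+1" and ?nr2.0="P+1"
          and ?nc1.0="P+1" and ?nc2.0="P+1"]) (simp_all add: *)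
qed

text \<open>The sum of the two forms sees only \<open>A\<close> plus its transpose. This carries
  summation by parts from matrix entries to arbitrary pairs of vectors.\<close>

lemma bilinear_symmetric_part:
  fixes A :: "real mat"
  assumes A: "A \<in> carrier_mat n n" and "0 < n"
    and sym: "\<And>i j. i < n \<Longrightarrow> j < n \<Longrightarrow>
      A $$ (i, j) + A $$ (j, i) = of_bool (i = n - 1 \<and> j = n - 1) - of_bool (i = 0 \<and> j = 0)"
    and v: "v \<in> carrier_vec n" and w: "w \<in> carrier_vec n"
  shows "v \<bullet> (A *\<^sub>v w) + w \<bullet> (A *\<^sub>v v) = v $ (n - 1) * w $ (n - 1) - v $ 0 * w $ 0"
proof -
  have "v \<bullet> (A *\<^sub>v w) = (\<Sum>i<n. \<Sum>j<n. v $ i * w $ j * A $$ (i, j))"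
    using A v w by (simp add: scalar_prod_def sum_distrib_left ac_simps lessThan_atLeast0)
  moreover have "w \<bullet> (A *\<^sub>v v) = (\<Sum>i<n. \<Sum>j<n. v $ i * w $ j * A $$ (j, i))"
    \<comment> \<open>Exchanging the sums aligns the weights \<open>v $ i * w $ j\<close> with those
      of the first form and transposes the entry of \<open>A\<close>.\<close>
    using A v w by (subst sum.swap) (simp add: scalar_prod_def sum_distrib_left ac_simps lessThan_atLeast0)
  ultimately have "v \<bullet> (A *\<^sub>v w) + w \<bullet> (A *\<^sub>v v)
      = (\<Sum>i<n. \<Sum>j<n. v $ i * w $ j * (A $$ (i, j) + A $$ (j, i)))"
    by (simp add: sum.distrib algebra_simps)
  \<comment> \<open>Nested conditionals, one index each, let both sums collapse by the delta
    rules.\<close>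
  also have "\<dots> = (\<Sum>i<n. \<Sum>j<n. (if j = n - 1 then if i = n - 1 then v $ i * w $ j else 0 else 0)
      - (if j = 0 then if i = 0 then v $ i * w $ j else 0 else 0))"
    by (intro sum.cong refl) (auto simp: sym)
  also have "\<dots> = v $ (n - 1) * w $ (n - 1) - v $ 0 * w $ 0"
    using \<open>0 < n\<close> by (simp add: sum_subtractf)
  finally show ?thesis .
qed

lemma interface_sbp:
  assumes "inj_on \<xi> {..P}" "\<xi> 0 = -1" "\<xi> P = 1" "\<And>k. k \<le> P \<Longrightarrow> 0 < \<omega> k" "0 < \<Delta>x"
    and M: "M = global_mass P \<omega> \<Delta>x"
    and B: "B = interface_mat P"
    and Dt: "Dt = global_deriv P \<xi> \<omega> \<Delta>x - (1 / 2) \<cdot>\<^sub>m (minv M * B)"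
    and v: "v \<in> carrier_vec (2 * P + 2)" and w: "w \<in> carrier_vec (2 * P + 2)"
  shows "v \<bullet> (M *\<^sub>v (Dt *\<^sub>v w)) + w \<bullet> (M *\<^sub>v (Dt *\<^sub>v v))
    = v $ (2 * P + 1) * w $ (2 * P + 1) - v $ 0 * w $ 0"
proof -
  let ?n = "2 * P + 2" and ?G = "global_deriv P \<xi> \<omega> \<Delta>x" and ?S = "ref_stiff P \<xi>"
    and ?O = "0\<^sub>m (P + 1) (P + 1) :: real mat"
  have carr: "M \<in> carrier_mat ?n ?n" "minv M \<in> carrier_mat ?n ?n" "B \<in> carrier_mat ?n ?n"
      "?G \<in> carrier_mat ?n ?n" "M * minv M = 1\<^sub>m ?n"
    using global_operators_carrier[of P \<omega> \<Delta>x] assms by simp_all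
  then have Dtc: "Dt \<in> carrier_mat ?n ?n" unfolding Dt by auto
  have "M * (minv M * B) = B"
    using carr by (simp flip: assoc_mult_mat[of _ ?n ?n _ ?n _ ?n])
  then have "M * Dt = M * ?G - (1 / 2) \<cdot>\<^sub>m B"
    using carr unfolding Dt by (simp add: mult_minus_distrib_mat[of _ ?n ?n _ ?n]
        mult_smult_distrib[of _ ?n ?n _ ?n])
  then have MDt: "M * Dt = four_block_mat ?S ?O ?O ?S - (1 / 2) \<cdot>\<^sub>m B"
    using mass_times_deriv[of P \<omega> \<Delta>x \<xi>] assms by simp
  have S: "dim_row ?S = P + 1" "dim_col ?S = P + 1" by (simp_all add: ref_stiff_def)
  \<comment> \<open>The off-diagonal blocks of \<open>B\<close> are negative transposes of each
    other and drop out. What survives are the diagonal entries at the two copies of the interface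
    node, \<open>P\<close> on the left and \<open>P + 1\<close> on the right.\<close>
  have B_entry: "B $$ (i, j) + B $$ (j, i) = 2 * (of_bool (i = P \<and> j = P) - of_bool (i = P + 1 \<and> j = P + 1))"
    if "i < ?n" "j < ?n" for i j
    using that unfolding B interface_mat_def Let_def outer_prod_def
    by (cases "i \<le> P"; cases "j \<le> P") auto
  have "(M * Dt) $$ (i, j) + (M * Dt) $$ (j, i)
      = of_bool (i = ?n - 1 \<and> j = ?n - 1) - of_bool (i = 0 \<and> j = 0)"
    if ij: "i < ?n" "j < ?n" for i j
  proof -
    have "(M * Dt) $$ (i, j) + (M * Dt) $$ (j, i)
        = four_block_mat ?S ?O ?O ?S $$ (i, j) + four_block_mat ?S ?O ?O ?S $$ (j, i)
          - (B $$ (i, j) + B $$ (j, i)) / 2"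
      using ij carr S unfolding MDt by (simp add: field_simps)
    \<comment> \<open>Each stiffness block contributes -1 at its left end and 1 at its right end.
      The entries at \<open>P\<close> and \<open>P + 1\<close> are exactly those that half of
      \<open>B_entry\<close> removes.\<close>
    also have "four_block_mat ?S ?O ?O ?S $$ (i, j) + four_block_mat ?S ?O ?O ?S $$ (j, i)
        = of_bool (i = P \<and> j = P) - of_bool (i = 0 \<and> j = 0)
          + of_bool (i = 2 * P + 1 \<and> j = 2 * P + 1) - of_bool (i = P + 1 \<and> j = P + 1)"
    proof -
      consider "i \<le> P" "j \<le> P" | "i > P" "j > P" | "i \<le> P" "j > P" | "i > P" "j \<le> P"
        by linarith
      then show ?thesis
      proof cases
        case 1
        then show ?thesis using ref_stiff_sbp[OF assms(1-3), of i j] S by simp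
      next
        case 2
        \<comment> \<open>Both indices exceed \<open>P\<close>, so the truncated subtraction is
          exact and local end nodes of the right element translate back to global indices.\<close>
        have "i - (P + 1) = P \<longleftrightarrow> i = 2 * P + 1" "i - (P + 1) = 0 \<longleftrightarrow> i = P + 1"
            "j - (P + 1) = P \<longleftrightarrow> j = 2 * P + 1" "j - (P + 1) = 0 \<longleftrightarrow> j = P + 1"
          using 2 by linarith+
        moreover have "i - (P + 1) \<le> P" "j - (P + 1) \<le> P" using ij by linarith+
        ultimately show ?thesis
          using ref_stiff_sbp[OF assms(1-3), of "i - (P + 1)" "j - (P + 1)"] 2 ij S by simp
      qed (use ij S in simp_all)
    qed
    finally show ?thesis using B_entry[OF ij] by simp
  qed
  then have "v \<bullet> ((M * Dt) *\<^sub>v w) + w \<bullet> ((M * Dt) *\<^sub>v v)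
      = v $ (?n - 1) * w $ (?n - 1) - v $ 0 * w $ 0"
    using carr Dtc v w by (intro bilinear_symmetric_part) auto
  then show ?thesis using carr Dtc v w by simp
qed

section \<open>Energy rate of the system written with \<open>Dt\<close>\<close>

lemma bilinear_commute:
  fixes A :: "real mat"
  assumes "A \<in> carrier_mat n n" "transpose_mat A = A" "v \<in> carrier_vec n" "w \<in> carrier_vec n"
  shows "v \<bullet> (A *\<^sub>v w) = w \<bullet> (A *\<^sub>v v)"
  using transpose_vec_mult_scalar[of A n n w v] assms
  by (simp add: comm_scalar_prod[of w n])

text \<open>Testing with \<open>v\<close> in the \<open>M\<close> inner product: \<open>M\<close>
  cancels the inverse mass of the penalty and the transpose of \<open>B\<close> moves onto
  \<open>v\<close>. With \<open>v = x\<close> the penalty becomes a multiple of the squared jump,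
  whose sign is known.\<close>

lemma weak_form:
  fixes M Mi A B :: "real mat"
  assumes "M \<in> carrier_mat n n" "Mi \<in> carrier_mat n n" "A \<in> carrier_mat n n" "B \<in> carrier_mat n n"
    and "M * Mi = 1\<^sub>m n"
    and "v \<in> carrier_vec n" "x \<in> carrier_vec n" "y \<in> carrier_vec n" "z \<in> carrier_vec n"
    and eq: "y + A *\<^sub>v z = c \<cdot>\<^sub>v ((Mi * transpose_mat B * B) *\<^sub>v x)"
  shows "v \<bullet> (M *\<^sub>v y) = c * ((B *\<^sub>v v) \<bullet> (B *\<^sub>v x)) - v \<bullet> (M *\<^sub>v (A *\<^sub>v z))"
proof -
  let ?b = "transpose_mat B *\<^sub>v (B *\<^sub>v x)"
  have b: "?b \<in> carrier_vec n" using assms by simp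
  have "v \<bullet> (M *\<^sub>v y) + v \<bullet> (M *\<^sub>v (A *\<^sub>v z)) = v \<bullet> (M *\<^sub>v (y + A *\<^sub>v z))"
    using assms(1-9) by (simp add: mult_add_distrib_mat_vec[of _ n n] scalar_prod_add_distrib[of _ n])
  also have "M *\<^sub>v (y + A *\<^sub>v z) = c \<cdot>\<^sub>v ((M * Mi) *\<^sub>v ?b)"
    unfolding eq using assms(1-4,6-9) b
    by (simp add: mult_mat_vec[of _ n n] assoc_mult_mat_vec[of _ n n _ n])
  also have "v \<bullet> (c \<cdot>\<^sub>v ((M * Mi) *\<^sub>v ?b)) = c * (?b \<bullet> v)"
    using assms b by (simp add: comm_scalar_prod[of v n])
  also have "?b \<bullet> v = (B *\<^sub>v x) \<bullet> (B *\<^sub>v v)"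
    using assms by (intro transpose_vec_mult_scalar) auto
  also have "\<dots> = (B *\<^sub>v v) \<bullet> (B *\<^sub>v x)"
    using assms by (intro comm_scalar_prod[of _ n]) auto
  finally show ?thesis by simp
qed

text \<open>The height equation is tested with \<open>g h\<close>, the velocity equation with
  \<open>H u\<close>. The left side is the energy derivative, up to the symmetry of
  \<open>M\<close>; \<open>m\<close> stands for the last node.\<close>

lemma energy_rate:
  fixes M Mi Dt B :: "real mat"
  assumes carr: "M \<in> carrier_mat n n" "Mi \<in> carrier_mat n n" "Dt \<in> carrier_mat n n" "B \<in> carrier_mat n n"
      "h \<in> carrier_vec n" "h' \<in> carrier_vec n" "u \<in> carrier_vec n" "u' \<in> carrier_vec n"
    and inv: "M * Mi = 1\<^sub>m n" and sym: "transpose_mat M = M" and "0 < n"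
    and sbp: "\<And>v w. v \<in> carrier_vec n \<Longrightarrow> w \<in> carrier_vec n \<Longrightarrow>
      v \<bullet> (M *\<^sub>v (Dt *\<^sub>v w)) + w \<bullet> (M *\<^sub>v (Dt *\<^sub>v v)) = v $ m * w $ m - v $ 0 * w $ 0"
    and m: "m < n"
    and h_eq: "h' + Dt *\<^sub>v (H \<cdot>\<^sub>v u + U \<cdot>\<^sub>v h) = (- \<alpha>h) \<cdot>\<^sub>v ((Mi * transpose_mat B * B) *\<^sub>v h)"
    and u_eq: "u' + Dt *\<^sub>v (g \<cdot>\<^sub>v h + U \<cdot>\<^sub>v u - (H\<^sup>2 * U / 3) \<cdot>\<^sub>v (Dt *\<^sub>v (Dt *\<^sub>v u)) - (H\<^sup>2 / 3) \<cdot>\<^sub>v (Dt *\<^sub>v u'))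
      = (- \<alpha>u) \<cdot>\<^sub>v ((Mi * transpose_mat B * B) *\<^sub>v u)"
  shows "g * (h \<bullet> (M *\<^sub>v h')) + H * (u \<bullet> (M *\<^sub>v u')) + H ^ 3 / 3 * ((Dt *\<^sub>v u') \<bullet> (M *\<^sub>v (Dt *\<^sub>v u)))
    = boundary_flux g H U Dt h u u' $ m - boundary_flux g H U Dt h u u' $ 0
      - g * \<alpha>h * ((B *\<^sub>v h) \<bullet> (B *\<^sub>v h)) - H * \<alpha>u * ((B *\<^sub>v u) \<bullet> (B *\<^sub>v u))"
proof -
  let ?w = "Dt *\<^sub>v u" and ?a = "\<lambda>v w. v \<bullet> (M *\<^sub>v (Dt *\<^sub>v w))"
  have vecs: "?w \<in> carrier_vec n" "Dt *\<^sub>v ?w \<in> carrier_vec n" "Dt *\<^sub>v u' \<in> carrier_vec n"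
    using carr by auto
  note lin = mult_add_distrib_mat_vec[of _ n n] mult_minus_distrib_mat_vec[of _ n n] mult_mat_vec[of _ n n]
    scalar_prod_add_distrib[of _ n] scalar_prod_minus_distrib[of _ n]
  have h: "h \<bullet> (M *\<^sub>v h') = - \<alpha>h * ((B *\<^sub>v h) \<bullet> (B *\<^sub>v h)) - (H * ?a h u + U * ?a h h)"
    using weak_form[OF carr(1-4) inv carr(5) carr(5) carr(6) _ h_eq] carr by (simp add: lin)
  have u: "u \<bullet> (M *\<^sub>v u') = - \<alpha>u * ((B *\<^sub>v u) \<bullet> (B *\<^sub>v u))
      - (g * ?a u h + U * ?a u u - H\<^sup>2 * U / 3 * ?a u (Dt *\<^sub>v ?w) - H\<^sup>2 / 3 * ?a u (Dt *\<^sub>v u'))"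
    using weak_form[OF carr(1-4) inv carr(7) carr(7) carr(8) _ u_eq] carr by (simp add: lin)
  have flux: "boundary_flux g H U Dt h u u' $ k =
     - (g * H * h $ k * u $ k) - g * U / 2 * (h $ k)\<^sup>2 - H * U / 2 * (u $ k)\<^sup>2
     + H ^ 3 * U / 3 * (u $ k * (Dt *\<^sub>v ?w) $ k - 1 / 2 * (?w $ k)\<^sup>2)
     + H ^ 3 / 3 * (u $ k * (Dt *\<^sub>v u') $ k)" if "k < n" for k
    using that carr unfolding boundary_flux_def by (simp del: index_mult_mat_vec add: assoc_mult_mat_vec[of _ n n _ n])
  \<comment> \<open>Summation by parts of \<open>Dt u\<close> against itself; the symmetry of
    \<open>M\<close> makes both summands equal, hence the factor 1/2. This controls the
    third-derivative term.\<close>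
  have ww: "(Dt *\<^sub>v ?w) \<bullet> (M *\<^sub>v ?w) = ((?w $ m)\<^sup>2 - (?w $ 0)\<^sup>2) / 2"
    using sbp[OF vecs(1,1)] bilinear_commute[OF carr(1) sym vecs(1,2)] by (simp add: power2_eq_square)
  \<comment> \<open>All forms are reduced to boundary values and the two interior terms
    \<open>?a u h\<close> and \<open>?a u (Dt *\<^sub>v u')\<close>. Each of these then occurs twice
    with opposite signs: the first in the coupling of height and velocity, the second between the
    dispersive term and the derivative part of the energy.\<close>
  have s: "?a h u = h $ m * u $ m - h $ 0 * u $ 0 - ?a u h"
      "?a h h = ((h $ m)\<^sup>2 - (h $ 0)\<^sup>2) / 2" "?a u u = ((u $ m)\<^sup>2 - (u $ 0)\<^sup>2) / 2"
      "?a u (Dt *\<^sub>v ?w) = u $ m * (Dt *\<^sub>v ?w) $ m - u $ 0 * (Dt *\<^sub>v ?w) $ 0 - ((?w $ m)\<^sup>2 - (?w $ 0)\<^sup>2) / 2"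
      "(Dt *\<^sub>v u') \<bullet> (M *\<^sub>v ?w) = u $ m * (Dt *\<^sub>v u') $ m - u $ 0 * (Dt *\<^sub>v u') $ 0 - ?a u (Dt *\<^sub>v u')"
    using sbp[OF carr(5,7)] sbp[OF carr(5,5)] sbp[OF carr(7,7)] sbp[OF carr(7) vecs(2), unfolded ww] sbp[OF carr(7) vecs(3)]
    by (simp_all add: power2_eq_square)
  show ?thesis unfolding flux[OF m] flux[OF \<open>0 < n\<close>] h u s by (simp add: field_simps power2_eq_square power3_eq_cube)
qed

section \<open>Differentiation of quadratic forms along vector curves\<close>

lemma scalar_prod_has_derivative:
  fixes v w :: "real \<Rightarrow> real Matrix.vec"
  assumes t: "t \<in> S"
    and "\<And>s. s \<in> S \<Longrightarrow> v s \<in> carrier_vec n" "\<And>s. s \<in> S \<Longrightarrow> w s \<in> carrier_vec n"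
    and "v' \<in> carrier_vec n" "w' \<in> carrier_vec n"
    and "\<And>i. i < n \<Longrightarrow> ((\<lambda>s. v s $ i) has_real_derivative v' $ i) (at t within S)"
    and "\<And>i. i < n \<Longrightarrow> ((\<lambda>s. w s $ i) has_real_derivative w' $ i) (at t within S)"
  shows "((\<lambda>s. v s \<bullet> w s) has_real_derivative v' \<bullet> w t + v t \<bullet> w') (at t within S)"
proof -
  have "((\<lambda>s. \<Sum>i<n. v s $ i * w s $ i) has_real_derivative
      (\<Sum>i<n. v' $ i * w t $ i + v t $ i * w' $ i)) (at t within S)"
    using assms(6,7) by (auto intro!: derivative_eq_intros sum.cong)
  moreover have "(\<Sum>i<n. v' $ i * w t $ i + v t $ i * w' $ i) = v' \<bullet> w t + v t \<bullet> w'"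
    using assms(2,3)[OF t] assms(4,5) by (simp add: scalar_prod_def sum.distrib lessThan_atLeast0)
  \<comment> \<open>The length of \<open>w s\<close> is known only for \<open>s\<close> in
    \<open>S\<close>, so the two functions agree only there. That suffices for a derivative within
    \<open>S\<close> at a point of \<open>S\<close>.\<close>
  moreover have "((\<lambda>s. \<Sum>i<n. v s $ i * w s $ i) has_real_derivative d) (at t within S)
      \<longleftrightarrow> ((\<lambda>s. v s \<bullet> w s) has_real_derivative d) (at t within S)" for d
    using t carrier_vecD[OF assms(3)]
    by (intro has_field_derivative_cong_ev)
       (auto simp: scalar_prod_def lessThan_atLeast0 intro: always_eventually)
  ultimately show ?thesis by simp
qed

lemma mult_mat_vec_has_derivative:
  fixes A :: "real mat"
  assumes "t \<in> S" and A: "A \<in> carrier_mat n n"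
    and "\<And>s. s \<in> S \<Longrightarrow> v s \<in> carrier_vec n" "v' \<in> carrier_vec n"
    and "\<And>i. i < n \<Longrightarrow> ((\<lambda>s. v s $ i) has_real_derivative v' $ i) (at t within S)"
    and "i < n"
  shows "((\<lambda>s. (A *\<^sub>v v s) $ i) has_real_derivative (A *\<^sub>v v') $ i) (at t within S)"
proof -
  \<comment> \<open>The row is treated as a constant curve, with derivative
    \<open>0\<^sub>v n\<close>, so that the product rule applies.\<close>
  have "((\<lambda>s. row A i \<bullet> v s) has_real_derivative 0\<^sub>v n \<bullet> v t + row A i \<bullet> v') (at t within S)"
    using assms by (intro scalar_prod_has_derivative[where n = n]) auto
  then show ?thesis using assms by simp
qed

lemma sq_norm_wrt_has_derivative:
  assumes t: "t \<in> S" and A: "A \<in> carrier_mat n n" "transpose_mat A = A"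
    and v: "\<And>s. s \<in> S \<Longrightarrow> v s \<in> carrier_vec n" and v': "v' \<in> carrier_vec n"
    and d: "\<And>i. i < n \<Longrightarrow> ((\<lambda>s. v s $ i) has_real_derivative v' $ i) (at t within S)"
  shows "((\<lambda>s. sq_norm_wrt A (v s)) has_real_derivative 2 * (v' \<bullet> (A *\<^sub>v v t))) (at t within S)"
proof -
  have "((\<lambda>s. sq_norm_wrt A (v s)) has_real_derivative v' \<bullet> (A *\<^sub>v v t) + v t \<bullet> (A *\<^sub>v v')) (at t within S)"
    unfolding sq_norm_wrt_def
    using assms mult_mat_vec_has_derivative[OF t A(1) v v' d]
    by (intro scalar_prod_has_derivative[where n = n]) auto
  moreover have "v t \<bullet> (A *\<^sub>v v') = v' \<bullet> (A *\<^sub>v v t)"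
    using A v[OF t] v' by (rule bilinear_commute)
  ultimately show ?thesis by simp
qed

section \<open>Absorbing the penalty terms into \<open>Dt\<close>\<close>

lemma smult_mult_mat_vec:
  fixes A :: "real mat"
  assumes "A \<in> carrier_mat nr nc" "v \<in> carrier_vec nc"
  shows "(k \<cdot>\<^sub>m A) *\<^sub>v v = k \<cdot>\<^sub>v (A *\<^sub>v v)"
  using assms by (intro eq_vecI) auto

text \<open>With coefficients 1/2 the penalties are \<open>K / 2\<close> applied to the flux
  \<open>H u + U h\<close>, and moving them to the left turns \<open>D\<close> into
  \<open>D - K / 2\<close>.\<close>

lemma height_scheme_factored:
  fixes D K :: "real mat"
  assumes carr: "D \<in> carrier_mat n n" "K \<in> carrier_mat n n"
      "h \<in> carrier_vec n" "h' \<in> carrier_vec n" "u \<in> carrier_vec n" "d \<in> carrier_vec n"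
    and scheme: "h' + D *\<^sub>v (H \<cdot>\<^sub>v u + U \<cdot>\<^sub>v h)
      = (1 / 2 * H) \<cdot>\<^sub>v (K *\<^sub>v u) + (1 / 2 * U) \<cdot>\<^sub>v (K *\<^sub>v h) - \<alpha> \<cdot>\<^sub>v d"
  shows "h' + (D - (1 / 2) \<cdot>\<^sub>m K) *\<^sub>v (H \<cdot>\<^sub>v u + U \<cdot>\<^sub>v h) = (- \<alpha>) \<cdot>\<^sub>v d"
proof (rule eq_vecI)
  note lin = mult_add_distrib_mat_vec[of _ n n] mult_mat_vec[of _ n n]
    minus_mult_distrib_mat_vec[of _ n n] smult_mult_mat_vec[of _ n n]
  fix i assume "i < dim_vec ((- \<alpha>) \<cdot>\<^sub>v d)"
  with carr have i: "i < n" by simp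
  \<comment> \<open>Componentwise, with \<open>index_mult_mat_vec\<close> removed so that components
    of matrix-vector products stay atoms; the claim becomes an identity linear in these
    atoms.\<close>
  show "(h' + (D - (1 / 2) \<cdot>\<^sub>m K) *\<^sub>v (H \<cdot>\<^sub>v u + U \<cdot>\<^sub>v h)) $ i = ((- \<alpha>) \<cdot>\<^sub>v d) $ i"
    using arg_cong[OF scheme, of "\<lambda>v. v $ i"] carr i
    by (simp add: lin field_simps del: index_mult_mat_vec)
qed (use carr in simp)

text \<open>The coefficients are those of the noncommutative expansions of
  \<open>(D - K / 2)^2 / 3\<close> and \<open>(D - K / 2)^3 / 3\<close>: each \<open>K\<close>
  brings a factor -1/2, so one, two or three of them give -1/6, 1/12 and -1/24.\<close>

lemma velocity_scheme_factored:
  fixes D K :: "real mat"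
  assumes carr: "D \<in> carrier_mat n n" "K \<in> carrier_mat n n"
      "h \<in> carrier_vec n" "u \<in> carrier_vec n" "u' \<in> carrier_vec n" "d \<in> carrier_vec n"
    and Dt: "Dt = D - (1 / 2) \<cdot>\<^sub>m K"
    and scheme: "u' + D *\<^sub>v (g \<cdot>\<^sub>v h + U \<cdot>\<^sub>v u
          - (H\<^sup>2 * U / 3) \<cdot>\<^sub>v ((D * D) *\<^sub>v u) - (H\<^sup>2 / 3) \<cdot>\<^sub>v (D *\<^sub>v u')) =
        (1 / 2 * g) \<cdot>\<^sub>v (K *\<^sub>v h) + (1 / 2 * U) \<cdot>\<^sub>v (K *\<^sub>v u)
        + H\<^sup>2 \<cdot>\<^sub>v (((- 1 / 6) \<cdot>\<^sub>m (D * K) + (- 1 / 6) \<cdot>\<^sub>m (K * D) + (1 / 12) \<cdot>\<^sub>m (K * K)) *\<^sub>v u')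
        + (H\<^sup>2 * U) \<cdot>\<^sub>v (((- 1 / 6) \<cdot>\<^sub>m (D * D * K) + (- 1 / 6) \<cdot>\<^sub>m (D * K * D) + (1 / 12) \<cdot>\<^sub>m (D * K * K)
             + (- 1 / 6) \<cdot>\<^sub>m (K * D * D) + (1 / 12) \<cdot>\<^sub>m (K * D * K) + (1 / 12) \<cdot>\<^sub>m (K * K * D)
             + (- 1 / 24) \<cdot>\<^sub>m (K * K * K)) *\<^sub>v u)
        - \<alpha> \<cdot>\<^sub>v d"
  shows "u' + Dt *\<^sub>v (g \<cdot>\<^sub>v h + U \<cdot>\<^sub>v u - (H\<^sup>2 * U / 3) \<cdot>\<^sub>v (Dt *\<^sub>v (Dt *\<^sub>v u))
      - (H\<^sup>2 / 3) \<cdot>\<^sub>v (Dt *\<^sub>v u')) = (- \<alpha>) \<cdot>\<^sub>v d"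
proof (rule eq_vecI)
  note lin = mult_add_distrib_mat_vec[of _ n n] mult_minus_distrib_mat_vec[of _ n n] mult_mat_vec[of _ n n]
    add_mult_distrib_mat_vec[of _ n n] minus_mult_distrib_mat_vec[of _ n n] smult_mult_mat_vec[of _ n n]
    assoc_mult_mat_vec[of _ n n _ n] assoc_mult_mat[of _ n n _ n _ n]
  fix i assume "i < dim_vec ((- \<alpha>) \<cdot>\<^sub>v d)"
  with carr have i: "i < n" by simp
  show "(u' + Dt *\<^sub>v (g \<cdot>\<^sub>v h + U \<cdot>\<^sub>v u - (H\<^sup>2 * U / 3) \<cdot>\<^sub>v (Dt *\<^sub>v (Dt *\<^sub>v u))
      - (H\<^sup>2 / 3) \<cdot>\<^sub>v (Dt *\<^sub>v u'))) $ i = ((- \<alpha>) \<cdot>\<^sub>v d) $ i"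
    using arg_cong[OF scheme, of "\<lambda>v. v $ i"] carr i unfolding Dt
    by (simp add: lin field_simps del: index_mult_mat_vec)
qed (use carr Dt in simp)

section \<open>Decay of the discrete energy\<close>

theorem theorem8:
  fixes P :: nat
    and \<xi> \<omega> :: "nat \<Rightarrow> real"
    and g H U \<Delta>x \<alpha>h \<alpha>u :: real
    and \<tau>11 \<tau>12 \<tau>21 \<tau>22 :: real
    and \<gamma>21 \<gamma>22 \<gamma>23 :: real
    and \<sigma>21 \<sigma>22 \<sigma>23 \<sigma>24 \<sigma>25 \<sigma>26 \<sigma>27 :: real
    and M D B K Dt :: "real mat"
    and h h' u u' :: "real \<Rightarrow> real Matrix.vec"
  assumes "0 < g" and "0 < H" and "1 \<le> P" and "0 < \<Delta>x" and "0 \<le> \<alpha>h" and "0 \<le> \<alpha>u"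
    and "gauss_lobatto P \<xi> \<omega>"
    and M: "M = global_mass P \<omega> \<Delta>x"
    and D: "D = global_deriv P \<xi> \<omega> \<Delta>x"
    and B: "B = interface_mat P"
    and K: "K = minv M * B"
    and Dt: "Dt = D - (1 / 2) \<cdot>\<^sub>m (minv M * B)"
    and tau: "\<tau>11 = 1 / 2" "\<tau>12 = 1 / 2" "\<tau>21 = 1 / 2" "\<tau>22 = 1 / 2"
    and gamma: "\<gamma>21 = - 1 / 6" "\<gamma>22 = - 1 / 6" "\<gamma>23 = 1 / 12"
    and sigma: "\<sigma>21 = - 1 / 6" "\<sigma>22 = - 1 / 6" "\<sigma>23 = 1 / 12" "\<sigma>24 = - 1 / 6"
      "\<sigma>25 = 1 / 12" "\<sigma>26 = 1 / 12" "\<sigma>27 = - 1 / 24"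
    and h_C1: "C1_with_deriv (2 * P + 2) h h'"
    and u_C1: "C1_with_deriv (2 * P + 2) u u'"
    and h_scheme: "\<forall>t\<ge>0.
      h' t + D *\<^sub>v (H \<cdot>\<^sub>v u t + U \<cdot>\<^sub>v h t) =
        (\<tau>11 * H) \<cdot>\<^sub>v (K *\<^sub>v u t) + (\<tau>12 * U) \<cdot>\<^sub>v (K *\<^sub>v h t)
        - \<alpha>h \<cdot>\<^sub>v ((minv M * transpose_mat B * B) *\<^sub>v h t)"
    and u_scheme: "\<forall>t\<ge>0.
      u' t + D *\<^sub>v (g \<cdot>\<^sub>v h t + U \<cdot>\<^sub>v u t
                     - (H\<^sup>2 * U / 3) \<cdot>\<^sub>v ((D * D) *\<^sub>v u t) - (H\<^sup>2 / 3) \<cdot>\<^sub>v (D *\<^sub>v u' t)) =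
        (\<tau>21 * g) \<cdot>\<^sub>v (K *\<^sub>v h t) + (\<tau>22 * U) \<cdot>\<^sub>v (K *\<^sub>v u t)
        + H\<^sup>2 \<cdot>\<^sub>v ((\<gamma>21 \<cdot>\<^sub>m (D * K) + \<gamma>22 \<cdot>\<^sub>m (K * D) + \<gamma>23 \<cdot>\<^sub>m (K * K)) *\<^sub>v u' t)
        + (H\<^sup>2 * U) \<cdot>\<^sub>v ((\<sigma>21 \<cdot>\<^sub>m (D * D * K) + \<sigma>22 \<cdot>\<^sub>m (D * K * D) + \<sigma>23 \<cdot>\<^sub>m (D * K * K)
             + \<sigma>24 \<cdot>\<^sub>m (K * D * D) + \<sigma>25 \<cdot>\<^sub>m (K * D * K) + \<sigma>26 \<cdot>\<^sub>m (K * K * D)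
             + \<sigma>27 \<cdot>\<^sub>m (K * K * K)) *\<^sub>v u t)
        - \<alpha>u \<cdot>\<^sub>v ((minv M * transpose_mat B * B) *\<^sub>v u t)"
    and interface_only: "\<forall>t\<ge>0.
      boundary_flux g H U Dt (h t) (u t) (u' t) $ (2 * P + 1)
        - boundary_flux g H U Dt (h t) (u t) (u' t) $ 0 = 0"
  shows "\<forall>t\<ge>0. energy g H M Dt (h t) (u t) \<le> energy g H M Dt (h 0) (u 0)"
proof -
  let ?n = "2 * P + 2"
  have \<xi>: "inj_on \<xi> {..P}" "\<xi> 0 = - 1" "\<xi> P = 1" "\<And>k. k \<le> P \<Longrightarrow> 0 < \<omega> k"
    using \<open>gauss_lobatto P \<xi> \<omega>\<close> by (auto simp: gauss_lobatto_def intro: strict_mono_on_imp_inj_on)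
  have carr: "M \<in> carrier_mat ?n ?n" "minv M \<in> carrier_mat ?n ?n" "D \<in> carrier_mat ?n ?n"
      "B \<in> carrier_mat ?n ?n" "M * minv M = 1\<^sub>m ?n" "transpose_mat M = M"
    using global_operators_carrier[of P \<omega> \<Delta>x] \<xi>(4) \<open>0 < \<Delta>x\<close> unfolding M D B by simp_all
  then have KDt: "K \<in> carrier_mat ?n ?n" "Dt \<in> carrier_mat ?n ?n" unfolding K Dt by auto
  have Dt_eq: "Dt = D - (1 / 2) \<cdot>\<^sub>m K" unfolding Dt K ..
  note sbp = interface_sbp[OF \<xi> \<open>0 < \<Delta>x\<close> M B Dt[unfolded D]]
  let ?E = "\<lambda>t. energy g H M Dt (h t) (u t)"
  \<comment> \<open>The energy rate once the outer flux difference is dropped: only the jump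
    dissipation is left.\<close>
  let ?R = "\<lambda>t. - g * \<alpha>h * ((B *\<^sub>v h t) \<bullet> (B *\<^sub>v h t)) - H * \<alpha>u * ((B *\<^sub>v u t) \<bullet> (B *\<^sub>v u t))"
  have rate: "(?E has_real_derivative ?R t) (at t within {0..})" if "0 \<le> t" for t
  proof -
    have t: "t \<in> {0..}" using that by simp
    have hu: "h s \<in> carrier_vec ?n" "u s \<in> carrier_vec ?n" "h' s \<in> carrier_vec ?n" "u' s \<in> carrier_vec ?n"
      if "s \<in> {0..}" for s
      using that h_C1 u_C1 by (auto simp: C1_with_deriv_def)
    have d: "((\<lambda>s. h s $ i) has_real_derivative h' t $ i) (at t within {0..})"
        "((\<lambda>s. u s $ i) has_real_derivative u' t $ i) (at t within {0..})" if "i < ?n" for i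
      using that t h_C1 u_C1 by (auto simp: C1_with_deriv_def)
    note hut = hu[OF t]
    note du = mult_mat_vec_has_derivative[OF t KDt(2) hu(2) hut(4) d(2)]
    have "(?E has_real_derivative
        g * (h' t \<bullet> (M *\<^sub>v h t)) + H * (u' t \<bullet> (M *\<^sub>v u t))
        + H ^ 3 / 3 * ((Dt *\<^sub>v u' t) \<bullet> (M *\<^sub>v (Dt *\<^sub>v u t)))) (at t within {0..})"
      unfolding energy_def
      using sq_norm_wrt_has_derivative[OF t carr(1,6) hu(1) hut(3) d(1)]
        sq_norm_wrt_has_derivative[OF t carr(1,6) hu(2) hut(4) d(2)]
        sq_norm_wrt_has_derivative[OF t carr(1,6) _ _ du] KDt(2) hu(2) hut
      by (auto intro!: derivative_eq_intros simp del: index_mult_mat_vec)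
    \<comment> \<open>Differentiating the norms puts the derivative in the left factor, whereas
      \<open>energy_rate\<close> tests the equations from the left.\<close>
    moreover have "h' t \<bullet> (M *\<^sub>v h t) = h t \<bullet> (M *\<^sub>v h' t)" "u' t \<bullet> (M *\<^sub>v u t) = u t \<bullet> (M *\<^sub>v u' t)"
      using bilinear_commute[OF carr(1,6)] hut by auto
    moreover
    let ?C = "minv M * transpose_mat B * B"
    have C: "?C *\<^sub>v h t \<in> carrier_vec ?n" "?C *\<^sub>v u t \<in> carrier_vec ?n"
      using carr hut by (auto intro!: mult_mat_vec_carrier[of _ _ ?n] mult_carrier_mat[of _ _ ?n])
    have h_eq: "h' t + Dt *\<^sub>v (H \<cdot>\<^sub>v u t + U \<cdot>\<^sub>v h t) = (- \<alpha>h) \<cdot>\<^sub>v (?C *\<^sub>v h t)"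
      unfolding Dt_eq using h_scheme that
      by (intro height_scheme_factored[OF carr(3) KDt(1) hut(1,3,2) C(1)]) (simp add: tau)
    have u_eq: "u' t + Dt *\<^sub>v (g \<cdot>\<^sub>v h t + U \<cdot>\<^sub>v u t - (H\<^sup>2 * U / 3) \<cdot>\<^sub>v (Dt *\<^sub>v (Dt *\<^sub>v u t))
        - (H\<^sup>2 / 3) \<cdot>\<^sub>v (Dt *\<^sub>v u' t)) = (- \<alpha>u) \<cdot>\<^sub>v (?C *\<^sub>v u t)"
      by (rule velocity_scheme_factored[OF carr(3) KDt(1) hut(1,2,4) C(2) Dt_eq
            u_scheme[rule_format, OF that, unfolded tau gamma sigma]])
    \<comment> \<open>\<open>sbp\<close> fixes \<open>m\<close> as \<open>2 * P + 1\<close>, so the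
      flux difference in \<open>energy_rate\<close> is the one that \<open>interface_only\<close>
      sets to zero.\<close>
    have "g * (h t \<bullet> (M *\<^sub>v h' t)) + H * (u t \<bullet> (M *\<^sub>v u' t))
        + H ^ 3 / 3 * ((Dt *\<^sub>v u' t) \<bullet> (M *\<^sub>v (Dt *\<^sub>v u t))) = ?R t"
      using energy_rate[OF carr(1,2) KDt(2) carr(4) hut(1,3,2,4) carr(5,6) _ sbp _ h_eq u_eq]
        interface_only that by simp
    ultimately show ?thesis by simp
  qed
  show ?thesis
  proof (intro allI impI)
    fix t :: real assume "0 \<le> t"
    show "?E t \<le> ?E 0"
    proof (rule DERIV_nonpos_imp_decreasing_open[OF \<open>0 \<le> t\<close>])
      fix x :: real assume "0 < x"
      then have "(?E has_real_derivative ?R x) (at x)"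
        using rate[of x] at_within_interior[of x "{0..}"] by simp
      moreover have "0 \<le> v \<bullet> v" for v :: "real Matrix.vec"
        by (simp add: scalar_prod_def sum_nonneg)
      then have "0 \<le> g * \<alpha>h * ((B *\<^sub>v h x) \<bullet> (B *\<^sub>v h x))" "0 \<le> H * \<alpha>u * ((B *\<^sub>v u x) \<bullet> (B *\<^sub>v u x))"
        using \<open>0 < g\<close> \<open>0 < H\<close> \<open>0 \<le> \<alpha>h\<close> \<open>0 \<le> \<alpha>u\<close> by simp_all
      then have "?R x \<le> 0" by simp
      ultimately show "\<exists>y. (?E has_real_derivative y) (at x) \<and> y \<le> 0" by blast
    next
      show "continuous_on {0..t} ?E"
        using rate by (intro DERIV_continuous_on[where D = ?R])
          (auto intro: has_field_derivative_subset[where s = "{0..}"])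
    qed
  qed
qed

end
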